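(* Let $H=(U,\mathcal{C})$ be a finite hypergraph with dual hypergraph $H^*$, which has vertices $\{v_C : C\in\mathcal{C}\}$ and hyperedges $\{e_u:u\in U\}$. Let $n_u$ ($u\in U$) be positive integers and let $P$ be a distribution in the graphical model on $H$ with clique potentials $\psi_C:\prod_{u\in C}[n_u]\to\mathbb{K}$, i.e. $P(x)=\frac1Z\prod_{C\in\mathcal{C}}\psi_C(x_C)$ for $x\in\prod_{u\in U}[n_u]$, with normalizing constant $Z=\sum_x\prod_{C}\psi_C(x_C)\neq 0$. Let $T_C=\psi_C\in\bigotimes_{u\in C}\mathbb{K}^{n_u}$ be the tensors of the dual tensor hypernetwork, placed at the vertices $v_C$ of $H^*$. Let $W\subseteq U$. Then the marginal distribution of $\{X_u\}_{u\in W}$ is $$P(x_W)=\frac1Z\sum_{\substack{x_u\in[n_u]:\\ u\notin W}}\ \prod_{C\in\mathcal{C}}(T_C)_{x_C},$$ which is, up to the factor $\frac1Z$, the tensor hypernetwork on $H^*$ contracted along the hyperedges $e_u$ corresponding to $u\in W^c=U\setminus W$.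
   Context: A (finite) hypergraph $H=(U,\mathcal{C})$ consists of a finite set $U$ of vertices and a finite family $\mathcal{C}$ of hyperedges, each a subset of $U$ (nested or repeated hyperedges, and hyperedges with one or no vertices, are allowed). The dual hypergraph $H^*$ has vertices $\{v_C: C\in\mathcal{C}\}$ and hyperedges $\{e_u: u\in U\}$, with $v_C\in e_u$ if and only if $u\in C$. Here $\mathbb{K}$ is a field (for genuine probability distributions the potentials take values in $\mathbb{R}_{\ge0}$), $[n]=\{1,\dots,n\}$, and for $S\subseteq U$ we write $x_S=(x_u)_{u\in S}$. The variable $X_u$ takes values in $[n_u]$. The marginal of $P$ on $W$ is $P(x_W)=\sum_{x_u\in[n_u],\,u\notin W}P(x)$. A tensor hypernetwork on a hypergraph $G=(V,E)$ has a positive integer $n_e$ for each $e\in E$ and a tensor $T_v\in\bigotimes_{e\ni v}\mathbb{K}^{n_e}$ for each $v\in V$. Its non-contracted state is the tensor with entries $\prod_{v\in V}(T_v)_{(i_e)_{e\ni v}}$ indexed by $(i_e)_{e\in E}$. Contracting along a set $F\subseteq E$ of hyperedges means summing this tensor over all values of the indices $i_e\in[n_e]$, $e\in F$, giving a tensor indexed by $(i_e)_{e\in E\setminus F}$. In the dual tensor hypernetwork on $H^*$ the hyperedge $e_u$ has size $n_u$. *)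

theory Defs
  imports "HOL-Analysis.Finite_Product_Measure"
begin

text \<open>
  The hyperedges form an indexed family: \<open>edges H\<close> is the set of hyperedge names and
  \<open>members H C\<close> is the vertex set of the hyperedge named \<open>C\<close>. So hyperedges may be
  repeated, nested, singletons or empty.
\<close>

record ('u, 'c) hypergraph =
  verts :: "'u set"
  edges :: "'c set"
  members :: "'c \<Rightarrow> 'u set"

definition finite_hypergraph :: "('u, 'c) hypergraph \<Rightarrow> bool" where
  "finite_hypergraph H \<longleftrightarrow>
     finite (verts H) \<and> finite (edges H) \<and> (\<forall>C\<in>edges H. members H C \<subseteq> verts H)"

text \<open>
  The vertex \<open>v\<^sub>C\<close> of the dual is named by \<open>C\<close> itself, and the hyperedge
  \<open>e\<^sub>u\<close> by \<open>u\<close>.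
\<close>

definition dual :: "('u, 'c) hypergraph \<Rightarrow> ('c, 'u) hypergraph" where
  "dual H = \<lparr>verts = edges H, edges = verts H,
             members = (\<lambda>u. {C \<in> edges H. u \<in> members H C})\<rparr>"

definition incident :: "('v, 'e) hypergraph \<Rightarrow> 'v \<Rightarrow> 'e set" where
  "incident G v = {e \<in> edges G. v \<in> members G e}"

text \<open>
  A tuple \<open>x\<^sub>S = (x\<^sub>u)\<close>, \<open>u \<in> S\<close>, is a function that is \<open>undefined\<close> outside \<open>S\<close>, so
  \<open>restrict x S\<close> is the subtuple \<open>x\<^sub>S\<close>, and \<open>merge S S' (x, y)\<close> is the tuple on \<open>S \<union> S'\<close>
  composed of \<open>x\<close> and \<open>y\<close>. Over the empty set there is exactly one tuple.
\<close>

definition tuples :: "('e \<Rightarrow> nat) \<Rightarrow> 'e set \<Rightarrow> ('e \<Rightarrow> nat) set" where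
  "tuples n S = (\<Pi>\<^sub>E e\<in>S. {1..n e})"

text \<open>
  An element of the tensor product of the coordinate spaces \<open>K^(n e)\<close>, \<open>e \<in> S\<close>, is given by its
  array of entries, i.e. by a function on \<open>tuples n S\<close>; it is \<open>undefined\<close> elsewhere, so that
  equality of tensors is equality of functions.
\<close>

definition tensors :: "('e \<Rightarrow> nat) \<Rightarrow> 'e set \<Rightarrow> (('e \<Rightarrow> nat) \<Rightarrow> 'k) set" where
  "tensors n S = (\<Pi>\<^sub>E i\<in>tuples n S. UNIV)"

definition tensor_hypernetwork ::
  "('v, 'e) hypergraph \<Rightarrow> ('e \<Rightarrow> nat) \<Rightarrow> ('v \<Rightarrow> ('e \<Rightarrow> nat) \<Rightarrow> 'k::field) \<Rightarrow> bool" where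
  "tensor_hypernetwork G n T \<longleftrightarrow>
     finite_hypergraph G \<and> (\<forall>e\<in>edges G. 0 < n e) \<and>
     (\<forall>v\<in>verts G. T v \<in> tensors n (incident G v))"

definition noncontracted_state ::
  "('v, 'e) hypergraph \<Rightarrow> ('e \<Rightarrow> nat) \<Rightarrow> ('v \<Rightarrow> ('e \<Rightarrow> nat) \<Rightarrow> 'k::field)
    \<Rightarrow> ('e \<Rightarrow> nat) \<Rightarrow> 'k" where
  "noncontracted_state G n T =
     (\<lambda>i\<in>tuples n (edges G). \<Prod>v\<in>verts G. T v (restrict i (incident G v)))"

definition contract_network ::
  "('v, 'e) hypergraph \<Rightarrow> ('e \<Rightarrow> nat) \<Rightarrow> ('v \<Rightarrow> ('e \<Rightarrow> nat) \<Rightarrow> 'k::field)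
    \<Rightarrow> 'e set \<Rightarrow> ('e \<Rightarrow> nat) \<Rightarrow> 'k" where
  "contract_network G n T F =
     (\<lambda>i\<in>tuples n (edges G - F).
        \<Sum>j\<in>tuples n F. noncontracted_state G n T (merge (edges G - F) F (i, j)))"

definition clique_potentials ::
  "('u, 'c) hypergraph \<Rightarrow> ('u \<Rightarrow> nat) \<Rightarrow> ('c \<Rightarrow> ('u \<Rightarrow> nat) \<Rightarrow> 'k::field) \<Rightarrow> bool" where
  "clique_potentials H n \<psi> \<longleftrightarrow>
     (\<forall>C\<in>edges H. \<psi> C \<in> (\<Pi>\<^sub>E x\<in>tuples n (members H C). UNIV))"

definition normalizing_constant ::
  "('u, 'c) hypergraph \<Rightarrow> ('u \<Rightarrow> nat) \<Rightarrow> ('c \<Rightarrow> ('u \<Rightarrow> nat) \<Rightarrow> 'k::field) \<Rightarrow> 'k" where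
  "normalizing_constant H n \<psi> =
     (\<Sum>x\<in>tuples n (verts H). \<Prod>C\<in>edges H. \<psi> C (restrict x (members H C)))"

definition in_graphical_model ::
  "('u, 'c) hypergraph \<Rightarrow> ('u \<Rightarrow> nat) \<Rightarrow> ('c \<Rightarrow> ('u \<Rightarrow> nat) \<Rightarrow> 'k::field)
    \<Rightarrow> (('u \<Rightarrow> nat) \<Rightarrow> 'k) \<Rightarrow> bool" where
  "in_graphical_model H n \<psi> P \<longleftrightarrow>
     clique_potentials H n \<psi> \<and> normalizing_constant H n \<psi> \<noteq> 0 \<and>
     (\<forall>x\<in>tuples n (verts H).
        P x = 1 / normalizing_constant H n \<psi> *
              (\<Prod>C\<in>edges H. \<psi> C (restrict x (members H C))))"

definition marginal ::
  "'u set \<Rightarrow> ('u \<Rightarrow> nat) \<Rightarrow> (('u \<Rightarrow> nat) \<Rightarrow> 'k::field) \<Rightarrow> 'u set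
    \<Rightarrow> ('u \<Rightarrow> nat) \<Rightarrow> 'k" where
  "marginal U n P W =
     (\<lambda>x\<in>tuples n W. \<Sum>y\<in>tuples n (U - W). P (merge W (U - W) (x, y)))"

end

theory Submission
  imports Defs
begin

text \<open>Dualizing swaps vertices and hyperedges, and the hyperedges of the dual at the vertex
  \<open>C\<close> are exactly the elements of \<open>members H C\<close>
  (\<open>incident_dual\<close>). Hence each potential already has the shape of a tensor at its
  vertex, and the entries of the non-contracted state are the unnormalized products of potentials
  (\<open>noncontracted_state_dual\<close>). Marginalizing over the variables outside
  \<open>W\<close> and contracting along their hyperedges are then one and the same sum, up to the
  constant factor \<open>1 / Z\<close>.\<close>

lemma dual_simps [simp]:
  "verts (dual H) = edges H"
  "edges (dual H) = verts H"
  "members (dual H) u = {C \<in> edges H. u \<in> members H C}"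
  by (simp_all add: dual_def)

lemma finite_hypergraph_dual: "finite_hypergraph H \<Longrightarrow> finite_hypergraph (dual H)"
  by (auto simp: finite_hypergraph_def)

text \<open>Incidence in the dual only sees elements of \<open>verts H\<close>; no member of
  \<open>C\<close> is lost, because a finite hypergraph has
  \<open>members H C \<subseteq> verts H\<close>.\<close>

lemma incident_dual:
  assumes "finite_hypergraph H" "C \<in> edges H"
  shows "incident (dual H) C = members H C"
  using assms by (auto simp: finite_hypergraph_def incident_def)

lemma merge_in_tuples:
  assumes "x \<in> tuples n S" "y \<in> tuples n S'"
  shows "merge S S' (x, y) \<in> tuples n (S \<union> S')"
  using assms by (auto simp: tuples_def merge_def PiE_iff extensional_def)

lemma noncontracted_state_dual:
  assumes "finite_hypergraph H" "x \<in> tuples n (verts H)"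
  shows "noncontracted_state (dual H) n T x = (\<Prod>C\<in>edges H. T C (restrict x (members H C)))"
  using assms by (simp add: noncontracted_state_def incident_dual)

theorem proposition3p7:
  fixes H :: "('u, 'c) hypergraph"
    and n :: "'u \<Rightarrow> nat"
    and \<psi> T :: "'c \<Rightarrow> ('u \<Rightarrow> nat) \<Rightarrow> 'k::field"
    and P :: "('u \<Rightarrow> nat) \<Rightarrow> 'k"
    and Z :: 'k
    and W :: "'u set"
  assumes "finite_hypergraph H"
    and "\<And>u. u \<in> verts H \<Longrightarrow> 0 < n u"
    and "in_graphical_model H n \<psi> P"
    and "Z = normalizing_constant H n \<psi>"
    and "\<And>C. C \<in> edges H \<Longrightarrow> T C = \<psi> C"
    and "W \<subseteq> verts H"
  shows "tensor_hypernetwork (dual H) n T \<and>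
    (\<forall>x\<in>tuples n W.
       marginal (verts H) n P W x =
         1 / Z * (\<Sum>y\<in>tuples n (verts H - W).
           \<Prod>C\<in>edges H. T C (restrict (merge W (verts H - W) (x, y)) (members H C)))) \<and>
    (\<lambda>x\<in>tuples n W. \<Sum>y\<in>tuples n (verts H - W).
        \<Prod>C\<in>edges H. T C (restrict (merge W (verts H - W) (x, y)) (members H C)))
      = contract_network (dual H) n T (verts H - W)"
proof (intro conjI ballI)
  \<comment> \<open>The formulas for \<open>P\<close> and for the non-contracted state are available
    only on full tuples, so the glued tuples must be shown to be such.\<close>
  have merge: "merge W (verts H - W) (x, y) \<in> tuples n (verts H)"
    if "x \<in> tuples n W" "y \<in> tuples n (verts H - W)" for x y
    using merge_in_tuples[OF that] assms(6) by (simp add: Un_absorb1)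
  show "tensor_hypernetwork (dual H) n T"
    using assms
    by (auto simp: tensor_hypernetwork_def finite_hypergraph_dual incident_dual tensors_def
        in_graphical_model_def clique_potentials_def)
  show "marginal (verts H) n P W x =
      1 / Z * (\<Sum>y\<in>tuples n (verts H - W).
        \<Prod>C\<in>edges H. T C (restrict (merge W (verts H - W) (x, y)) (members H C)))"
    if "x \<in> tuples n W" for x
    \<comment> \<open>Moving \<open>1 / Z\<close> inside the sum lets the two sides be compared term
      by term.\<close>
    unfolding sum_distrib_left marginal_def restrict_apply'[OF that]
    using assms(3,4,5) merge[OF that]
    by (intro sum.cong) (simp_all add: in_graphical_model_def)
  \<comment> \<open>Contraction leaves open the indices in the complement of the contracted set;
    this double complement is \<open>W\<close> since \<open>W \<subseteq> verts H\<close>.\<close>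
  have "verts H - (verts H - W) = W"
    using assms(6) by blast
  then show "(\<lambda>x\<in>tuples n W. \<Sum>y\<in>tuples n (verts H - W).
        \<Prod>C\<in>edges H. T C (restrict (merge W (verts H - W) (x, y)) (members H C)))
      = contract_network (dual H) n T (verts H - W)"
    using merge assms(1)
    by (auto simp: contract_network_def noncontracted_state_dual intro!: restrict_ext sum.cong)
qed

end
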